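(* Let $k\in\mathbb{R}$, $\mathbf{D}\in\mathbb{R}^{3N\times3N}$, $\widetilde{\mathbf{G}}\in\mathbb{C}^{N\times N}$, $\widetilde{\mathbf{H}}\in\mathbb{C}^{M\times3N}$, $\widetilde{\mathbf{u}}^{\mathrm{in}}\in\mathbb{C}^{3N}$ and $\widetilde{\mathbf{y}}\in\mathbb{C}^M$ be fixed. For $\widetilde{\mathbf{f}}\in\mathbb{R}^N$ put $$\widetilde{\mathbf{A}}=\widetilde{\mathbf{A}}(\widetilde{\mathbf{f}}):=\mathbf{I}-(k^2\mathbf{I}+\mathbf{D})\left(\mathbf{I}_3\otimes(\widetilde{\mathbf{G}}\,\mathrm{diag}(\widetilde{\mathbf{f}}))\right)$$ and, whenever $\widetilde{\mathbf{A}}$ is non-singular, $\widetilde{\mathbf{u}}:=\widetilde{\mathbf{A}}^{-1}\widetilde{\mathbf{u}}^{\mathrm{in}}\in\mathbb{C}^{3N}$, $\widetilde{\mathcal{Z}}(\widetilde{\mathbf{f}}):=\widetilde{\mathbf{H}}\left(\mathbf{I}_3\otimes\mathrm{diag}(\widetilde{\mathbf{f}})\right)\widetilde{\mathbf{u}}$ and $\mathcal{D}(\widetilde{\mathbf{f}}):=\frac12\|\widetilde{\mathbf{y}}-\widetilde{\mathcal{Z}}(\widetilde{\mathbf{f}})\|^2$. Let $\widetilde{\mathbf{f}}\in\mathbb{R}^N$ be such that $\widetilde{\mathbf{A}}$ is non-singular, let $\widetilde{\mathbf{w}}=\widetilde{\mathcal{Z}}(\widetilde{\mathbf{f}})-\widetilde{\mathbf{y}}$,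 and let $$\mathbf{g}=\mathrm{diag}(\widetilde{\mathbf{u}})^{\mathsf H}\left(\widetilde{\mathbf{H}}^{\mathsf H}\widetilde{\mathbf{w}}+(\mathbf{I}_3\otimes\widetilde{\mathbf{G}}^{\mathsf H})(k^2\mathbf{I}+\mathbf{D}^{\mathsf H})\widetilde{\mathbf{v}}\right)\in\mathbb{C}^{3N},$$ where $\widetilde{\mathbf{u}}$ and $\widetilde{\mathbf{v}}$ are obtained from the linear systems $$\widetilde{\mathbf{A}}\widetilde{\mathbf{u}}=\widetilde{\mathbf{u}}^{\mathrm{in}},\qquad\widetilde{\mathbf{A}}^{\mathsf H}\widetilde{\mathbf{v}}=(\mathbf{I}_3\otimes\mathrm{diag}(\widetilde{\mathbf{f}}))\widetilde{\mathbf{H}}^{\mathsf H}\widetilde{\mathbf{w}}.$$ Then $$\nabla\mathcal{D}(\widetilde{\mathbf{f}})=\mathrm{Re}\left\{\sum_{i=1}^3\mathbf{g}^{(i)}\right\},\qquad \mathbf{g}^{(i)}=(g_{(i-1)N+1},\ldots,g_{iN})\in\mathbb{C}^N,\quad i=1,2,3.$$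
   Context: $\mathrm{diag}(\mathbf{a})$ is the diagonal matrix with the vector $\mathbf{a}$ on its diagonal; $(\cdot)^{\mathsf H}$ is the conjugate transpose; $\otimes$ is the Kronecker product; $\mathbf{I}_3$ is the $3\times3$ identity and $\mathbf{I}$ the identity of size $3N$; $\mathrm{Re}$ is the entrywise real part. $\nabla\mathcal{D}(\widetilde{\mathbf{f}})\in\mathbb{R}^N$ is the gradient of the real-valued function $\mathcal{D}$ with respect to the real vector $\widetilde{\mathbf{f}}$. (In the application, $k$ is the wavenumber, $\mathbf{D}$ is the matrix of a finite-difference gradient-divergence operator, $\widetilde{\mathbf{G}}$ is the matrix of convolution with the 3D free-space scalar Green's function, $\widetilde{\mathbf{H}}$ is the matrix of convolution with the third row of the dyadic Green's function, $\widetilde{\mathbf{u}}$ stacks the three components of the total electric field, and $\widetilde{\mathbf{f}}$ is the real permittivity contrast.) *)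

theory Defs
  imports "HOL-Analysis.Analysis"
begin

text \<open>
  A vector of size \<open>3N\<close> is indexed by pairs \<open>(i, j) :: 3 \<times> 'n\<close> with \<open>CARD('n) = N\<close>: the pair
  stands for the position \<open>(i - 1) N + j\<close>, so the first component selects the block and the second
  the position within it. In the numeral type \<open>3\<close> the third index is \<open>3 = 0\<close>.
\<close>

definition block :: "'i::finite \<Rightarrow> 'a ^ ('i \<times> 'n::finite) \<Rightarrow> 'a ^ 'n" where
  "block i x = (\<chi> j. x $ (i, j))"

definition kronecker ::
  "'a::times ^ 'n::finite ^ 'm::finite \<Rightarrow> 'a ^ 'q::finite ^ 'p::finite \<Rightarrow> 'a ^ ('n \<times> 'q) ^ ('m \<times> 'p)" where
  "kronecker A B = (\<chi> r c. A $ fst r $ fst c * B $ snd r $ snd c)"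

definition diag :: "'a::zero ^ 'n::finite \<Rightarrow> 'a ^ 'n ^ 'n" where
  "diag a = (\<chi> i j. if i = j then a $ i else 0)"

definition ctranspose :: "complex ^ 'n::finite ^ 'm::finite \<Rightarrow> complex ^ 'm ^ 'n" where
  "ctranspose A = map_matrix cnj (transpose A)"

definition cvec :: "real ^ 'n::finite \<Rightarrow> complex ^ 'n" where
  "cvec x = (\<chi> i. complex_of_real (x $ i))"

definition Re_vec :: "complex ^ 'n::finite \<Rightarrow> real ^ 'n" where
  "Re_vec x = (\<chi> i. Re (x $ i))"

definition system_matrix ::
  "real \<Rightarrow> real ^ (3 \<times> 'n::finite) ^ (3 \<times> 'n) \<Rightarrow> complex ^ 'n ^ 'n \<Rightarrow> real ^ 'n
    \<Rightarrow> complex ^ (3 \<times> 'n) ^ (3 \<times> 'n)" where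
  "system_matrix k D G f =
     mat 1 - (k\<^sup>2 *\<^sub>R mat 1 + map_matrix complex_of_real D)
             ** kronecker (mat 1 :: complex ^ 3 ^ 3) (G ** diag (cvec f))"

text \<open>
  The next three functions are meaningful only where the system matrix is invertible; elsewhere
  \<open>matrix_inv\<close> is an unspecified matrix. As the invertible matrices form an open set, these values
  do not affect a gradient taken at a point with invertible system matrix.
\<close>

definition total_field ::
  "real \<Rightarrow> real ^ (3 \<times> 'n::finite) ^ (3 \<times> 'n) \<Rightarrow> complex ^ 'n ^ 'n \<Rightarrow> complex ^ (3 \<times> 'n)
    \<Rightarrow> real ^ 'n \<Rightarrow> complex ^ (3 \<times> 'n)" where
  "total_field k D G uin f = matrix_inv (system_matrix k D G f) *v uin"

definition forward_model ::
  "real \<Rightarrow> real ^ (3 \<times> 'n::finite) ^ (3 \<times> 'n) \<Rightarrow> complex ^ 'n ^ 'n \<Rightarrow> complex ^ (3 \<times> 'n) ^ 'm::finite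
    \<Rightarrow> complex ^ (3 \<times> 'n) \<Rightarrow> real ^ 'n \<Rightarrow> complex ^ 'm" where
  "forward_model k D G H uin f =
     H *v (kronecker (mat 1 :: complex ^ 3 ^ 3) (diag (cvec f)) *v total_field k D G uin f)"

definition data_fidelity ::
  "real \<Rightarrow> real ^ (3 \<times> 'n::finite) ^ (3 \<times> 'n) \<Rightarrow> complex ^ 'n ^ 'n \<Rightarrow> complex ^ (3 \<times> 'n) ^ 'm::finite
    \<Rightarrow> complex ^ (3 \<times> 'n) \<Rightarrow> complex ^ 'm \<Rightarrow> real ^ 'n \<Rightarrow> real" where
  "data_fidelity k D G H uin y f = 1 / 2 * (norm (y - forward_model k D G H uin f))\<^sup>2"

end

theory Submission
  imports Defs
begin

text \<open>
  For an invertible \<open>A x\<close> the solution of \<open>A y *v s y = b\<close> satisfies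
  \<open>s y - s x = - (A x)\<inverse> (A y - A x) s y\<close>. This identity first bounds \<open>s\<close> near \<open>x\<close> and then shows
  that \<open>s\<close> is differentiable. The gradient follows by moving every matrix to the other side of the
  real inner product \<open>Re (x\<^sup>H y)\<close>: the adjoint system for \<open>v\<close> absorbs the inverse of the system matrix.
\<close>

section \<open>Differentiating the solution of a linear system\<close>

lemma bounded_bilinear_matrix_vector_mult:
  "bounded_bilinear ((*v) :: complex ^ 'n::finite ^ 'm::finite \<Rightarrow> complex ^ 'n \<Rightarrow> complex ^ 'm)"
proof (subst bilinear_conv_bounded_bilinear [symmetric], unfold bilinear_def, intro conjI allI)
  show "linear ((*v) A)" for A :: "complex ^ 'n ^ 'm"
    by (rule linearI)
      (simp_all add: matrix_vector_mult_def vec_eq_iff sum.distrib scaleR_sum_right algebra_simps)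
  show "linear (\<lambda>A. A *v x)" for x :: "complex ^ 'n"
    by (rule linearI)
      (simp_all add: matrix_vector_mult_def vec_eq_iff sum.distrib scaleR_sum_right algebra_simps)
qed

text \<open>The squared norm is the inner product of \<open>A y - A x\<close> with itself. Both
  factors vanish at \<open>x\<close>, so the product rule gives derivative zero, and anything
  bounded by a multiple of it is \<open>o(norm (y - x))\<close>. No Lipschitz constant for
  \<open>A\<close> has to be named.\<close>

lemma has_derivative_zero_of_square_bound:
  fixes r :: "'a::real_normed_vector \<Rightarrow> 'b::real_normed_vector"
    and A :: "'a \<Rightarrow> 'c::real_inner"
  assumes A: "(A has_derivative A') (at x)"
    and bound: "\<forall>\<^sub>F y in at x. norm (r y) \<le> C * (norm (A y - A x))\<^sup>2"
    and "r x = 0"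
  shows "(r has_derivative (\<lambda>_. 0)) (at x)"
proof -
  have "((\<lambda>y. (A y - A x) \<bullet> (A y - A x)) has_derivative (\<lambda>_. 0)) (at x)"
    by (rule has_derivative_eq_rhs, (rule derivative_intros A)+) simp
  then have "((\<lambda>y. norm ((A y - A x) \<bullet> (A y - A x)) / norm (y - x)) \<longlongrightarrow> 0) (at x)"
    by (simp add: has_derivative_iff_norm)
  then have "((\<lambda>y. C * (norm ((A y - A x) \<bullet> (A y - A x)) / norm (y - x))) \<longlongrightarrow> 0) (at x)"
    by (rule tendsto_mult_right_zero)
  then have "((\<lambda>y. norm (r y) / norm (y - x)) \<longlongrightarrow> 0) (at x)"
    by (rule Lim_null_comparison [rotated])
      (use bound in \<open>auto elim!: eventually_mono simp: power2_norm_eq_inner divide_right_mono\<close>)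
  then show ?thesis
    using \<open>r x = 0\<close> by (simp add: has_derivative_iff_norm)
qed

lemma matrix_inv_mult_cancel:
  fixes A :: "'a::field ^ 'n::finite ^ 'n"
  assumes "invertible A"
  shows "matrix_inv A *v (A *v x) = x" "A *v (matrix_inv A *v x) = x"
proof -
  have "A ** matrix_inv A = mat 1 \<and> matrix_inv A ** A = mat 1"
    using assms unfolding invertible_def matrix_inv_def by (rule someI_ex)
  then show "matrix_inv A *v (A *v x) = x" "A *v (matrix_inv A *v x) = x"
    by (simp_all add: matrix_vector_mul_assoc)
qed

lemma has_derivative_matrix_inv_mult:
  fixes A :: "'a::real_normed_vector \<Rightarrow> complex ^ 'n::finite ^ 'n"
  assumes A: "(A has_derivative A') (at x)" and inv: "invertible (A x)"
  shows "((\<lambda>y. matrix_inv (A y) *v b) has_derivative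
           (\<lambda>h. - (matrix_inv (A x) *v (A' h *v (matrix_inv (A x) *v b))))) (at x)"
proof -
  interpret bil: bounded_bilinear "(*v) :: complex ^ 'n ^ 'n \<Rightarrow> _ \<Rightarrow> _"
    by (rule bounded_bilinear_matrix_vector_mult)
  define P where "P = matrix_inv (A x)"
  define s where "s y = matrix_inv (A y) *v b" for y
  define E where "E y = A y - A x" for y
  note cancel = matrix_inv_mult_cancel [OF inv, folded P_def]
  obtain K where K: "K > 0"
    "\<And>M z :: complex ^ 'n. norm ((M :: complex ^ 'n ^ 'n) *v z) \<le> norm M * norm z * K"
    using bil.pos_bounded by blast
  \<comment> \<open>The summand \<open>1\<close> makes \<open>C\<close> positive whatever the norm
    of \<open>P\<close> is, so that \<open>1 / (2 * C)\<close> can serve as a radius.\<close>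
  define C where "C = norm P * K * K + 1"
  have C: "C > 0"
    using K(1) by (auto simp: C_def intro!: add_nonneg_pos)
  have PE: "norm (P *v (E y *v z)) \<le> C * norm (E y) * norm z" for y z
  proof -
    have "norm (P *v (E y *v z)) \<le> norm P * norm (E y *v z) * K"
      by (rule K)
    also have "\<dots> \<le> norm P * (norm (E y) * norm z * K) * K"
      using K by (intro mult_right_mono mult_left_mono) auto
    also have "\<dots> = (norm P * K * K) * (norm (E y) * norm z)"
      by (simp add: mult_ac)
    also have "\<dots> \<le> C * (norm (E y) * norm z)"
      by (intro mult_right_mono) (auto simp: C_def)
    finally show ?thesis
      by (simp add: mult_ac)
  qed
  have "(E \<longlongrightarrow> 0) (at x)"
    using has_derivative_continuous [OF A] unfolding continuous_within E_def by (rule LIM_zero)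
  then have "\<forall>\<^sub>F y in at x. norm (E y) < 1 / (2 * C)"
    using C by (auto simp: tendsto_iff)
  then have small: "\<forall>\<^sub>F y in at x. C * norm (E y) \<le> 1 / 2"
    by eventually_elim (use C in \<open>simp add: field_simps\<close>)
  \<comment> \<open>On the kernel of \<open>A y\<close>, the map \<open>P E y\<close> acts as minus
    the identity. Its norm there is at most \<open>1 / 2\<close>, so the kernel is trivial.\<close>
  have invertible_near: "invertible (A y)" if y: "C * norm (E y) \<le> 1 / 2" for y
  proof -
    have "z = 0" if "A y *v z = 0" for z
    proof -
      have "P *v (E y *v z) = - z"
        using that cancel(1) by (simp add: E_def bil.diff_left bil.minus_right)
      then have "norm z \<le> C * norm (E y) * norm z"
        using PE [of y z] by simp
      also have "\<dots> \<le> 1 / 2 * norm z"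
        using y by (rule mult_right_mono) simp
      finally show ?thesis
        by simp
    qed
    then have "inj ((*v) (A y))"
      by (metis bil.diff_right eq_iff_diff_eq_0 injI)
    then show ?thesis
      using matrix_left_invertible_injective invertible_left_inverse by blast
  qed
  have diff: "s y - s x = - (P *v (E y *v s y))" if y: "invertible (A y)" for y
  proof -
    have "E y *v s y = b - A x *v s y"
      using matrix_inv_mult_cancel(2) [OF y, of b] by (simp add: E_def s_def bil.diff_left)
    then show ?thesis
      by (simp add: bil.diff_right cancel) (simp add: s_def P_def)
  qed
  \<comment> \<open>The remainder after the expected first-order term: \<open>s y\<close> in the
    exact identity \<open>diff\<close> is frozen at \<open>s x\<close>.\<close>
  define r where "r y = s y - s x + P *v (E y *v s x)" for y
  have "\<forall>\<^sub>F y in at x. norm (r y) \<le> (C * C * 2 * norm (s x)) * (norm (A y - A x))\<^sup>2"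
    using small
  proof eventually_elim
    case (elim y)
    have d: "s y - s x = - (P *v (E y *v s y))"
      using elim by (intro diff invertible_near)
    \<comment> \<open>The increment is at most half of \<open>norm (s y)\<close>, which the left
      side absorbs. This bounds \<open>s\<close> near \<open>x\<close> without prior
      continuity.\<close>
    have "norm (s y) \<le> norm (s x) + norm (s y - s x)"
      by (metis add.commute norm_triangle_sub)
    also have "norm (s y - s x) \<le> C * norm (E y) * norm (s y)"
      using PE d by simp
    also have "\<dots> \<le> 1 / 2 * norm (s y)"
      using elim by (rule mult_right_mono) simp
    finally have sy: "norm (s y) \<le> 2 * norm (s x)"
      by simp
    \<comment> \<open>The increment \<open>s y - s x\<close> carries a second factor
      \<open>E y\<close>, hence the quadratic bound.\<close>
    have "r y = - (P *v (E y *v (s y - s x)))"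
      unfolding r_def by (subst d) (simp add: bil.diff_right)
    then have "norm (r y) \<le> C * norm (E y) * norm (s y - s x)"
      using PE by simp
    also have "\<dots> \<le> C * norm (E y) * (C * norm (E y) * norm (s y))"
      using PE C d by (intro mult_left_mono) auto
    also have "\<dots> \<le> C * norm (E y) * (C * norm (E y) * (2 * norm (s x)))"
      using sy C by (intro mult_left_mono) auto
    finally show ?case
      by (simp add: E_def power2_eq_square mult_ac)
  qed
  then have "(r has_derivative (\<lambda>_. 0)) (at x)"
    by (rule has_derivative_zero_of_square_bound [OF A]) (simp add: r_def E_def)
  moreover have "((\<lambda>y. P *v (E y *v s x)) has_derivative (\<lambda>h. P *v (A' h *v s x))) (at x)"
    unfolding E_def
    by (rule has_derivative_eq_rhs,
        (rule derivative_intros A bounded_linear.has_derivative [OF bil.bounded_linear_left]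
          bounded_linear.has_derivative [OF bil.bounded_linear_right])+) simp
  ultimately have "((\<lambda>y. r y - P *v (E y *v s x) + s x) has_derivative
      (\<lambda>h. 0 - P *v (A' h *v s x) + 0)) (at x)"
    by (intro derivative_intros)
  then show ?thesis
    by (simp add: r_def s_def P_def)
qed

section \<open>Adjoints, Kronecker products and block sums\<close>

lemma inner_complex_eq_Re: "(a :: complex) \<bullet> b = Re (cnj a * b)"
  by (simp add: inner_complex_def)

lemma inner_ctranspose:
  fixes M :: "complex ^ 'n::finite ^ 'm::finite"
  shows "x \<bullet> (M *v z) = (ctranspose M *v x) \<bullet> z"
proof -
  have "x \<bullet> (M *v z) = Re (\<Sum>i\<in>UNIV. \<Sum>j\<in>UNIV. cnj (x $ i) * (M $ i $ j * z $ j))"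
    by (simp add: inner_vec_def inner_complex_eq_Re matrix_vector_mult_def sum_distrib_left)
  also have "\<dots> = Re (\<Sum>j\<in>UNIV. \<Sum>i\<in>UNIV. cnj (x $ i) * (M $ i $ j * z $ j))"
    by (subst sum.swap) (rule refl)
  also have "\<dots> = (ctranspose M *v x) \<bullet> z"
    by (simp add: inner_vec_def inner_complex_eq_Re matrix_vector_mult_def ctranspose_def
        transpose_def map_matrix_def sum_distrib_left mult_ac del: times_complex.sel)
  finally show ?thesis .
qed

text \<open>Of the sum over pairs, the identity factor keeps a single block index. The rule splits
  the system matrix so that \<open>f\<close> enters only through the real-linear factor built from
  \<open>diag (cvec f)\<close>.\<close>

lemma kronecker_mat_1_mult:
  fixes A :: "'a::comm_semiring_1 ^ 'n::finite ^ 'm::finite" and B :: "'a ^ 'p::finite ^ 'n"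
  shows "kronecker (mat 1 :: 'a ^ 'i::finite ^ 'i) (A ** B)
    = kronecker (mat 1 :: 'a ^ 'i ^ 'i) A ** kronecker (mat 1 :: 'a ^ 'i ^ 'i) B"
proof -
  let ?I = "mat 1 :: 'a ^ 'i ^ 'i"
  have "(\<Sum>p\<in>UNIV. ?I $ i $ fst p * A $ r $ snd p
        * (?I $ fst p $ j * B $ snd p $ c))
      = ?I $ i $ j * (\<Sum>q\<in>UNIV. A $ r $ q * B $ q $ c)" for i j r c
  proof -
    have "(\<Sum>p\<in>UNIV. ?I $ i $ fst p * A $ r $ snd p
        * (?I $ fst p $ j * B $ snd p $ c))
      = (\<Sum>l\<in>UNIV. if l = i
          then (\<Sum>q\<in>UNIV. A $ r $ q * (?I $ l $ j * B $ q $ c)) else 0)"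
      unfolding UNIV_Times_UNIV [symmetric] sum.cartesian_product'
      by (intro sum.cong refl) (auto simp: mat_def)
    then show ?thesis
      by (simp add: sum_distrib_left mult_ac)
  qed
  then show ?thesis
    by (simp add: kronecker_def matrix_matrix_mult_def vec_eq_iff)
qed

lemma ctranspose_kronecker_mat_1:
  "ctranspose (kronecker (mat 1 :: complex ^ 'i::finite ^ 'i) A)
    = kronecker (mat 1 :: complex ^ 'i ^ 'i) (ctranspose A)"
  by (auto simp: ctranspose_def kronecker_def transpose_def map_matrix_def vec_eq_iff mat_def)

lemma kronecker_mat_1_diag_mult:
  fixes a :: "'a::comm_semiring_1 ^ 'n::finite" and z :: "'a ^ ('i::finite \<times> 'n)"
  shows "kronecker (mat 1 :: 'a ^ 'i ^ 'i) (diag a) *v z = (\<chi> p. a $ snd p * z $ p)"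
proof -
  have "(kronecker (mat 1 :: 'a ^ 'i ^ 'i) (diag a) *v z) $ p
      = (\<Sum>q\<in>UNIV. if q = p then a $ snd p * z $ p else 0)" for p
    unfolding matrix_vector_mult_def kronecker_def diag_def mat_def
    by (auto intro!: sum.cong simp: prod_eq_iff)
  then show ?thesis
    by (simp add: vec_eq_iff)
qed

text \<open>This is where the real part and the sum of blocks come from. Each real entry
  \<open>h $ j\<close> multiplies position \<open>j\<close> of all three blocks, so collecting its
  coefficient adds the blocks, and the real inner product takes the real part.\<close>

lemma inner_kronecker_diag_mult:
  fixes z x :: "complex ^ (3 \<times> 'n::finite)"
  shows "z \<bullet> (kronecker (mat 1 :: complex ^ 3 ^ 3) (diag (cvec h)) *v x)
    = h \<bullet> Re_vec (\<Sum>i\<in>UNIV. block i (ctranspose (diag x) *v z))"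
proof -
  have adj: "(ctranspose (diag x) *v z) $ p = cnj (x $ p) * z $ p" for p
  proof -
    have "(ctranspose (diag x) *v z) $ p
        = (\<Sum>q\<in>UNIV. if q = p then cnj (x $ p) * z $ p else 0)"
      unfolding matrix_vector_mult_def ctranspose_def diag_def map_matrix_def transpose_def
      by (simp only: vec_lambda_beta, intro sum.cong) auto
    then show ?thesis
      by simp
  qed
  have "z \<bullet> (kronecker (mat 1 :: complex ^ 3 ^ 3) (diag (cvec h)) *v x)
      = (\<Sum>i\<in>UNIV. \<Sum>j\<in>UNIV. h $ j * Re (cnj (x $ (i, j)) * z $ (i, j)))"
    unfolding kronecker_mat_1_diag_mult inner_vec_def UNIV_Times_UNIV [symmetric]
      sum.cartesian_product'
    by (simp add: inner_complex_eq_Re cvec_def algebra_simps)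
  also have "\<dots> = (\<Sum>j\<in>UNIV. \<Sum>i\<in>UNIV. h $ j * Re (cnj (x $ (i, j)) * z $ (i, j)))"
    by (rule sum.swap)
  also have "\<dots> = h \<bullet> Re_vec (\<Sum>i\<in>UNIV. block i (ctranspose (diag x) *v z))"
    by (simp add: inner_vec_def Re_vec_def block_def adj sum_distrib_left)
  finally show ?thesis .
qed

lemma ctranspose_add: "ctranspose (A + B) = ctranspose A + ctranspose B"
  by (simp add: ctranspose_def transpose_def map_matrix_def vec_eq_iff)

lemma ctranspose_scaleR_mat_1: "ctranspose (c *\<^sub>R mat 1) = c *\<^sub>R mat 1"
  by (simp add: ctranspose_def transpose_def map_matrix_def vec_eq_iff mat_def)

lemma linear_kronecker_diag:
  "linear (\<lambda>h. kronecker (mat 1 :: complex ^ 'i::finite ^ 'i) (diag (cvec h)))"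
  by (rule linearI)
    (simp_all add: kronecker_def diag_def cvec_def vec_eq_iff
      scaleR_conv_of_real [where 'a = complex] algebra_simps)

section \<open>The gradient by the adjoint method\<close>

theorem mainTheorem4:
  fixes k :: real
    and D :: "real ^ (3 \<times> 'n::finite) ^ (3 \<times> 'n)"
    and G :: "complex ^ 'n ^ 'n"
    and H :: "complex ^ (3 \<times> 'n) ^ 'm::finite"
    and uin u v g :: "complex ^ (3 \<times> 'n)"
    and y w :: "complex ^ 'm"
    and f :: "real ^ 'n"
  assumes nonsingular: "invertible (system_matrix k D G f)"
    and w: "w = forward_model k D G H uin f - y"
    and u: "system_matrix k D G f *v u = uin"
    and v: "ctranspose (system_matrix k D G f) *v v
              = kronecker (mat 1 :: complex ^ 3 ^ 3) (diag (cvec f)) *v (ctranspose H *v w)"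
    and g: "g = ctranspose (diag u) *v
              (ctranspose H *v w
               + kronecker (mat 1 :: complex ^ 3 ^ 3) (ctranspose G)
                 *v ((k\<^sup>2 *\<^sub>R mat 1 + ctranspose (map_matrix complex_of_real D)) *v v))"
  shows "GDERIV (data_fidelity k D G H uin y) f :> Re_vec (\<Sum>i\<in>(UNIV :: 3 set). block i g)"
proof -
  define L where "L h = kronecker (mat 1 :: complex ^ 3 ^ 3) (diag (cvec h))" for h :: "real ^ 'n"
  define Q where "Q = kronecker (mat 1 :: complex ^ 3 ^ 3) G"
  define K where "K = k\<^sup>2 *\<^sub>R mat 1 + map_matrix complex_of_real D"
  define A where "A = system_matrix k D G"
  define P where "P = matrix_inv (A f)"
  \<comment> \<open>The derivative of the field in direction \<open>h\<close>. The minus sign from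
    differentiating the inverse cancels the one in \<open>A = I - K Q L\<close>.\<close>
  define u' where "u' h = P *v (K *v (Q *v (L h *v u)))" for h
  interpret bil: bounded_bilinear "(*v) :: complex ^ (3 \<times> 'n) ^ (3 \<times> 'n) \<Rightarrow> _ \<Rightarrow> _"
    by (rule bounded_bilinear_matrix_vector_mult)
  interpret bilH: bounded_bilinear "(*v) :: complex ^ (3 \<times> 'n) ^ 'm \<Rightarrow> _ \<Rightarrow> _"
    by (rule bounded_bilinear_matrix_vector_mult)
  have u_eq: "P *v uin = u"
    using matrix_inv_mult_cancel(1) [OF nonsingular, of u] by (simp add: P_def A_def u)
  have A_eq: "A h = mat 1 - K ** (Q ** L h)" for h
    by (simp add: A_def system_matrix_def K_def Q_def L_def kronecker_mat_1_mult)
  have "linear L"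
    unfolding L_def by (rule linear_kronecker_diag)
  then have L: "(L has_derivative L) (at f)"
    by (simp add: linear_imp_has_derivative)
  have "linear (\<lambda>M :: complex ^ (3 \<times> 'n) ^ (3 \<times> 'n). K ** (Q ** M))"
    by (rule linearI)
      (simp_all add: matrix_add_ldistrib matrix_scalar_ac scalar_matrix_assoc [symmetric])
  then have "linear (\<lambda>h. K ** (Q ** L h))"
    using linear_compose [OF \<open>linear L\<close>] by (simp add: o_def)
  then have "((\<lambda>h. K ** (Q ** L h)) has_derivative (\<lambda>h. K ** (Q ** L h))) (at f)"
    by (rule linear_imp_has_derivative)
  then have "(A has_derivative (\<lambda>h. 0 - K ** (Q ** L h))) (at f)"
    unfolding A_eq [abs_def] by (intro derivative_intros)
  from has_derivative_matrix_inv_mult [OF this, of uin]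
  have field: "(total_field k D G uin has_derivative u') (at f)"
    using nonsingular
    by (simp add: total_field_def [abs_def] A_def [symmetric] P_def [symmetric] u_eq u'_def [abs_def]
        bil.minus_left bil.minus_right matrix_vector_mul_assoc)
  define Z where "Z = forward_model k D G H uin"
  \<comment> \<open>Product rule: the contrast acts through the field and also as an explicit
    factor.\<close>
  define Z' where "Z' h = H *v (L f *v u' h + L h *v u)" for h
  have Z: "(Z has_derivative Z') (at f)"
    using bounded_linear.has_derivative [OF bilH.bounded_linear_right bil.FDERIV [OF L field]]
    by (simp add: Z_def Z'_def [abs_def] forward_model_def [abs_def] L_def [symmetric]
        total_field_def A_def [symmetric] P_def [symmetric] u_eq)
  have "(data_fidelity k D G H uin y has_derivative (\<lambda>h. w \<bullet> Z' h)) (at f)"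
    unfolding data_fidelity_def [abs_def] power2_norm_eq_inner Z_def [symmetric]
    by (rule has_derivative_eq_rhs, (rule derivative_intros Z)+)
      (auto simp: w Z_def fun_eq_iff inner_commute algebra_simps)
  moreover have "w \<bullet> Z' h = h \<bullet> Re_vec (\<Sum>i\<in>UNIV. block i g)" for h
  proof -
    have ctK: "ctranspose K = k\<^sup>2 *\<^sub>R mat 1 + ctranspose (map_matrix complex_of_real D)"
      by (simp add: K_def ctranspose_add ctranspose_scaleR_mat_1)
    \<comment> \<open>A real diagonal matrix is self-adjoint, so moving \<open>L f\<close> across
      the inner product yields exactly the right-hand side of the system for
      \<open>v\<close>.\<close>
    have ctL: "ctranspose (L f) = L f"
      by (auto simp: L_def ctranspose_def kronecker_def transpose_def map_matrix_def mat_def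
          diag_def cvec_def vec_eq_iff)
    have "w \<bullet> Z' h = (ctranspose H *v w) \<bullet> (L h *v u) + (L f *v (ctranspose H *v w)) \<bullet> u' h"
      by (simp add: Z'_def inner_ctranspose inner_add_right ctL)
    \<comment> \<open>The adjoint system turns the left factor into
      \<open>ctranspose (A f) *v v\<close>. Moved back, \<open>A f\<close> cancels the inverse
      \<open>P\<close> in \<open>u' h\<close>, and both terms then pair with
      \<open>L h *v u\<close>.\<close>
    also have "(L f *v (ctranspose H *v w)) \<bullet> u' h = v \<bullet> (A f *v u' h)"
      using v by (simp add: inner_ctranspose A_def L_def)
    also have "A f *v u' h = K *v (Q *v (L h *v u))"
      using matrix_inv_mult_cancel(2) [OF nonsingular] by (simp add: u'_def P_def A_def)
    also have "v \<bullet> \<dots> = (ctranspose Q *v (ctranspose K *v v)) \<bullet> (L h *v u)"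
      by (simp add: inner_ctranspose)
    also have "(ctranspose H *v w) \<bullet> (L h *v u) + \<dots>
        = (ctranspose H *v w + ctranspose Q *v (ctranspose K *v v)) \<bullet> (L h *v u)"
      by (rule inner_add_left [symmetric])
    finally show ?thesis
      by (simp only: L_def inner_kronecker_diag_mult g ctK [symmetric] Q_def
          ctranspose_kronecker_mat_1)
  qed
  ultimately show ?thesis
    by (simp add: gderiv_def)
qed

end
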